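(* Let $\Omega$ be a set. Then $(\mathcal{PT}_\Omega,<,>)$ is a dendriform algebra; that is, writing $S\mathbin{\mathrm{sh}^T}T:=S<T+S>T$, for all $S,T,U\in\mathcal{PT}_\Omega$ one has $$(S<T)<U=S<(T\mathbin{\mathrm{sh}^T}U),\qquad (S>T)<U=S>(T<U),\qquad (S\mathbin{\mathrm{sh}^T}T)>U=S>(T>U).$$
   Context: $\mathbb K$ is a fixed field. A planar rooted tree is a finite rooted tree in which the children of every vertex are linearly ordered from left to right. For a set $\Omega$, $\mathrm{PT}_\Omega$ is the set of (isomorphism classes of) non-empty planar rooted trees with vertices decorated by elements of $\Omega$, and $\mathcal{PT}_\Omega$ is the $\mathbb K$-vector space with basis $\mathrm{PT}_\Omega$. For $x\in\Omega$ and trees $T_1,\dots,T_k$ ($k\ge 0$), $B_+^x(T_1\cdots T_k)$ is the tree obtained by grafting $T_1,\dots,T_k$, in this order, on a new root decorated by $x$; it is extended multilinearly in $T_1,\dots,T_k$. $B_+^x(\emptyset)$ is the one-vertex tree decorated by $x$. Every tree is uniquely of the form $B_+^x(T_1\cdots T_k)$, $k\ge0$. The products $<$ and $>$ (and $\mathrm{sh}^T:={<}+{>}$) are the bilinear products on $\mathcal{PT}_\Omega$ defined on trees by induction on the total number of vertices: for $S=B_+^x(S_1\cdots S_k)$ and $T=B_+^y(T_1\cdots T_\ell)$, $$S<T:=\begin{cases}B_+^x(T)&k=0,\\ B_+^x\big(S_1\cdots S_{k-1}(S_k\mathbin{\mathrm{sh}^T}T)\big)&k\ge1,\end{cases}\qquad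 S>T:=\begin{cases}B_+^y(S)&\ell=0,\\ B_+^y\big((S\mathbin{\mathrm{sh}^T}T_1)T_2\cdots T_\ell\big)&\ell\ge1.\end{cases}$$ A dendriform algebra is a vector space $A$ with two bilinear operations $\prec,\succ$ such that, with $\star=\prec+\succ$, for all $a,b,c\in A$: $(a\prec b)\prec c=a\prec(b\star c)$, $(a\succ b)\prec c=a\succ(b\prec c)$, $(a\star b)\succ c=a\succ(b\succ c)$. *)

theory Defs
  imports Complex_Main "HOL-Library.Poly_Mapping"
begin

section \<open>Dendriform algebras\<close>

text \<open>The underlying space is a linear subspace \<open>A\<close> of an ambient vector space, and all axioms
  are relativised to \<open>A\<close>.\<close>

locale dendriform_algebra = vector_space scale
  for scale :: "'k::field \<Rightarrow> 'v::ab_group_add \<Rightarrow> 'v" +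
  fixes A :: "'v set"
    and prec :: "'v \<Rightarrow> 'v \<Rightarrow> 'v" (infixl "\<prec>" 65)
    and succ :: "'v \<Rightarrow> 'v \<Rightarrow> 'v" (infixl "\<succ>" 65)
  assumes subspace_A: "subspace A"
    and prec_closed: "\<lbrakk>a \<in> A; b \<in> A\<rbrakk> \<Longrightarrow> a \<prec> b \<in> A"
    and succ_closed: "\<lbrakk>a \<in> A; b \<in> A\<rbrakk> \<Longrightarrow> a \<succ> b \<in> A"
    and prec_add_left: "\<lbrakk>a \<in> A; b \<in> A; c \<in> A\<rbrakk> \<Longrightarrow> (a + b) \<prec> c = (a \<prec> c) + (b \<prec> c)"
    and prec_add_right: "\<lbrakk>a \<in> A; b \<in> A; c \<in> A\<rbrakk> \<Longrightarrow> a \<prec> (b + c) = (a \<prec> b) + (a \<prec> c)"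
    and prec_scale_left: "\<lbrakk>a \<in> A; b \<in> A\<rbrakk> \<Longrightarrow> scale r a \<prec> b = scale r (a \<prec> b)"
    and prec_scale_right: "\<lbrakk>a \<in> A; b \<in> A\<rbrakk> \<Longrightarrow> a \<prec> scale r b = scale r (a \<prec> b)"
    and succ_add_left: "\<lbrakk>a \<in> A; b \<in> A; c \<in> A\<rbrakk> \<Longrightarrow> (a + b) \<succ> c = (a \<succ> c) + (b \<succ> c)"
    and succ_add_right: "\<lbrakk>a \<in> A; b \<in> A; c \<in> A\<rbrakk> \<Longrightarrow> a \<succ> (b + c) = (a \<succ> b) + (a \<succ> c)"
    and succ_scale_left: "\<lbrakk>a \<in> A; b \<in> A\<rbrakk> \<Longrightarrow> scale r a \<succ> b = scale r (a \<succ> b)"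
    and succ_scale_right: "\<lbrakk>a \<in> A; b \<in> A\<rbrakk> \<Longrightarrow> a \<succ> scale r b = scale r (a \<succ> b)"
    and prec_prec: "\<lbrakk>a \<in> A; b \<in> A; c \<in> A\<rbrakk> \<Longrightarrow> (a \<prec> b) \<prec> c = a \<prec> ((b \<prec> c) + (b \<succ> c))"
    and succ_prec: "\<lbrakk>a \<in> A; b \<in> A; c \<in> A\<rbrakk> \<Longrightarrow> (a \<succ> b) \<prec> c = a \<succ> (b \<prec> c)"
    and succ_succ: "\<lbrakk>a \<in> A; b \<in> A; c \<in> A\<rbrakk> \<Longrightarrow> ((a \<prec> b) + (a \<succ> b)) \<succ> c = a \<succ> (b \<succ> c)"

section \<open>Planar rooted trees and the space they span\<close>

text \<open>The type \<open>'a ptree\<close> has exactly one element per isomorphism class of non-empty planar rooted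
  trees with vertices decorated by \<open>'a\<close>; \<open>set_ptree T\<close> is the set of decorations occurring in \<open>T\<close>.\<close>

datatype 'a ptree = Node 'a "'a ptree list"

definition PT_trees :: "'a set \<Rightarrow> 'a ptree set" where
  "PT_trees \<Omega> = {T. set_ptree T \<subseteq> \<Omega>}"

text \<open>\<open>'b \<Rightarrow>\<^sub>0 'k\<close> is the free vector space with basis \<open>'b\<close>; the library provides its additive group
  but no scalar multiplication.\<close>

definition pm_scale :: "'k::field \<Rightarrow> ('b \<Rightarrow>\<^sub>0 'k) \<Rightarrow> ('b \<Rightarrow>\<^sub>0 'k)" where
  "pm_scale r f = Poly_Mapping.map (\<lambda>x. r * x) f"

definition basis_vec :: "'b \<Rightarrow> ('b \<Rightarrow>\<^sub>0 'k::field)" where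
  "basis_vec b = Poly_Mapping.single b 1"

definition PT_space :: "'a set \<Rightarrow> ('a ptree \<Rightarrow>\<^sub>0 'k::field) set" where
  "PT_space \<Omega> = {f. Poly_Mapping.keys f \<subseteq> PT_trees \<Omega>}"

definition linear_ext :: "('b \<Rightarrow> ('d \<Rightarrow>\<^sub>0 'k::field)) \<Rightarrow> ('b \<Rightarrow>\<^sub>0 'k) \<Rightarrow> ('d \<Rightarrow>\<^sub>0 'k)" where
  "linear_ext g f = (\<Sum>s\<in>Poly_Mapping.keys f. pm_scale (Poly_Mapping.lookup f s) (g s))"

definition bilinear_ext ::
  "('b \<Rightarrow> 'c \<Rightarrow> ('d \<Rightarrow>\<^sub>0 'k::field)) \<Rightarrow> ('b \<Rightarrow>\<^sub>0 'k) \<Rightarrow> ('c \<Rightarrow>\<^sub>0 'k) \<Rightarrow> ('d \<Rightarrow>\<^sub>0 'k)" where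
  "bilinear_ext g f h = linear_ext (\<lambda>s. linear_ext (g s) h) f"

text \<open>The multilinear extension of \<open>(T\<^sub>1, \<dots>, T\<^sub>k) \<mapsto> [T\<^sub>1, \<dots>, T\<^sub>k]\<close>, with values in the span of forests.\<close>

fun forest :: "('b \<Rightarrow>\<^sub>0 'k::field) list \<Rightarrow> ('b list \<Rightarrow>\<^sub>0 'k)" where
  "forest [] = basis_vec []"
| "forest (f # fs) = bilinear_ext (\<lambda>t ts. basis_vec (t # ts)) f (forest fs)"

definition B_plus :: "'a \<Rightarrow> ('a ptree \<Rightarrow>\<^sub>0 'k::field) list \<Rightarrow> ('a ptree \<Rightarrow>\<^sub>0 'k)" where
  "B_plus x fs = linear_ext (\<lambda>ts. basis_vec (Node x ts)) (forest fs)"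

section \<open>The two products\<close>

function tree_lt :: "'a ptree \<Rightarrow> 'a ptree \<Rightarrow> ('a ptree \<Rightarrow>\<^sub>0 'k::field)"
  and tree_gt :: "'a ptree \<Rightarrow> 'a ptree \<Rightarrow> ('a ptree \<Rightarrow>\<^sub>0 'k::field)" where
  "tree_lt (Node x Ss) T =
     (if Ss = [] then B_plus x [basis_vec T]
      else B_plus x (map basis_vec (butlast Ss) @ [tree_lt (last Ss) T + tree_gt (last Ss) T]))"
| "tree_gt S (Node y Ts) =
     (if Ts = [] then B_plus y [basis_vec S]
      else B_plus y ((tree_lt S (hd Ts) + tree_gt S (hd Ts)) # map basis_vec (tl Ts)))"
  by pat_completeness auto

lemma size_child_less: "T \<in> set Ts \<Longrightarrow> size T < size (Node x Ts)"
  by (induction Ts) auto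

termination
  by (relation "measure (case_sum (\<lambda>(S, T). size S + size T) (\<lambda>(S, T). size S + size T))")
    (auto intro: size_child_less simp del: ptree.size)

definition PT_lt :: "('a ptree \<Rightarrow>\<^sub>0 'k::field) \<Rightarrow> ('a ptree \<Rightarrow>\<^sub>0 'k) \<Rightarrow> ('a ptree \<Rightarrow>\<^sub>0 'k)"
    (infixl "<\<^sub>T" 65) where
  "S <\<^sub>T T = bilinear_ext tree_lt S T"

definition PT_gt :: "('a ptree \<Rightarrow>\<^sub>0 'k::field) \<Rightarrow> ('a ptree \<Rightarrow>\<^sub>0 'k) \<Rightarrow> ('a ptree \<Rightarrow>\<^sub>0 'k)"
    (infixl ">\<^sub>T" 65) where
  "S >\<^sub>T T = bilinear_ext tree_gt S T"

definition PT_sh :: "('a ptree \<Rightarrow>\<^sub>0 'k::field) \<Rightarrow> ('a ptree \<Rightarrow>\<^sub>0 'k) \<Rightarrow> ('a ptree \<Rightarrow>\<^sub>0 'k)"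
    (infixl "sh\<^sub>T" 65) where
  "S sh\<^sub>T T = (S <\<^sub>T T) + (S >\<^sub>T T)"

end

theory Submission
  imports Defs
begin

text \<open>By trilinearity the identities only need to be checked on trees, by induction on the total
  size. There \<open><\<close> acts on the last child of the root and \<open>>\<close> on the first one, so each axiom reduces
  to associativity of \<open>sh\<^sup>T\<close> for a smaller triple, which is the sum of the three axioms. The
  only interaction between the two sides occurs in \<open>(S > T) < U = S > (T < U)\<close> when \<open>T\<close> has
  at most one child.\<close>

section \<open>Linear extension\<close>

lemma lookup_pm_scale [simp]:
  "Poly_Mapping.lookup (pm_scale r f) s = r * Poly_Mapping.lookup f s"
  by (simp add: pm_scale_def map.rep_eq when_def)

interpretation pm: vector_space "pm_scale :: 'k::field \<Rightarrow> ('b \<Rightarrow>\<^sub>0 'k) \<Rightarrow> ('b \<Rightarrow>\<^sub>0 'k)"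
  by unfold_locales (auto intro!: poly_mapping_eqI simp: lookup_add algebra_simps)

text \<open>The extra indices carry coefficient zero. Enlarging the index set lets vectors with
  different supports be summed over one common finite set.\<close>

lemma linear_ext_superset:
  assumes "finite A" "Poly_Mapping.keys f \<subseteq> A"
  shows "linear_ext g f = (\<Sum>s\<in>A. pm_scale (Poly_Mapping.lookup f s) (g s))"
  unfolding linear_ext_def using assms
  by (intro sum.mono_neutral_left) (auto simp: in_keys_iff)

lemma linear_ext_add [simp]: "linear_ext g (f + f') = linear_ext g f + linear_ext g f'"
proof -
  let ?A = "Poly_Mapping.keys f \<union> Poly_Mapping.keys f'"
  have "linear_ext g h = (\<Sum>s\<in>?A. pm_scale (Poly_Mapping.lookup h s) (g s))"
    if "h \<in> {f, f', f + f'}" for h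
    using that Poly_Mapping.keys_add[of f f'] by (intro linear_ext_superset) auto
  then show ?thesis
    by (simp add: lookup_add pm.scale_left_distrib sum.distrib)
qed

lemma linear_ext_scale [simp]: "linear_ext g (pm_scale r f) = pm_scale r (linear_ext g f)"
proof -
  have "Poly_Mapping.keys (pm_scale r f) \<subseteq> Poly_Mapping.keys f"
    by (auto simp: in_keys_iff)
  then have "linear_ext g (pm_scale r f) =
      (\<Sum>s\<in>Poly_Mapping.keys f. pm_scale (Poly_Mapping.lookup (pm_scale r f) s) (g s))"
    by (intro linear_ext_superset) auto
  then show ?thesis
    by (simp add: linear_ext_def pm.scale_sum_right)
qed

lemma linear_ext_basis [simp]: "linear_ext g (basis_vec s) = g s"
  by (simp add: linear_ext_def basis_vec_def)

lemma linear_ext_add_fun: "linear_ext (\<lambda>s. g s + h s) f = linear_ext g f + linear_ext h f"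
  by (simp add: linear_ext_def pm.scale_right_distrib sum.distrib)

lemma linear_ext_scale_fun: "linear_ext (\<lambda>s. pm_scale r (g s)) f = pm_scale r (linear_ext g f)"
  by (simp add: linear_ext_def pm.scale_sum_right mult.commute)

lemma bilinear_ext_simps [simp]:
  "bilinear_ext g (f + f') h = bilinear_ext g f h + bilinear_ext g f' h"
  "bilinear_ext g f (h + h') = bilinear_ext g f h + bilinear_ext g f h'"
  "bilinear_ext g (pm_scale r f) h = pm_scale r (bilinear_ext g f h)"
  "bilinear_ext g f (pm_scale r h) = pm_scale r (bilinear_ext g f h)"
  "bilinear_ext g (basis_vec s) h = linear_ext (g s) h"
  by (simp_all add: bilinear_ext_def linear_ext_add_fun linear_ext_scale_fun)

lemma basis_expansion:
  "f = (\<Sum>s\<in>Poly_Mapping.keys f. pm_scale (Poly_Mapping.lookup f s) (basis_vec s))"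
  by (rule poly_mapping_eqI)
    (simp add: lookup_sum basis_vec_def lookup_single when_def in_keys_iff if_distrib
      cong: if_cong)

text \<open>Basis vectors span the space, so an identity whose two sides are linear in
  \<open>f\<close> need only be checked on basis vectors. Later proofs apply this to one argument at
  a time.\<close>

lemma linear_induct [case_names basis add scale]:
  assumes "\<And>s. P (basis_vec s)"
    and add: "\<And>f g. P f \<Longrightarrow> P g \<Longrightarrow> P (f + g)"
    and scale: "\<And>r f. P f \<Longrightarrow> P (pm_scale r f)"
  shows "P f"
proof -
  have "P 0"
    \<comment> \<open>The zero vector is the multiple by 0 of some basis vector, so the rule needs
      no separate case for it.\<close>
    using scale[of "basis_vec undefined" 0] assms(1) by simp
  then have "P (\<Sum>s\<in>A. pm_scale (c s) (basis_vec s))" for A c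
    by (induction A rule: infinite_finite_induct) (auto intro: assms)
  then show ?thesis
    by (subst basis_expansion)
qed

lemma linear_ext_in_subspace:
  assumes "pm.subspace V" "\<And>s. s \<in> Poly_Mapping.keys f \<Longrightarrow> g s \<in> V"
  shows "linear_ext g f \<in> V"
  unfolding linear_ext_def using assms by (intro pm.subspace_sum pm.subspace_scale) auto

section \<open>Grafting\<close>

lemma forest_basis: "forest (map basis_vec ts) = basis_vec ts"
  by (induction ts) simp_all

text \<open>The recursion of \<open>tree_gt\<close> calls \<open>B_plus\<close> with basis vectors
  in all slots but the first, so the multilinear extension collapses to a linear one.\<close>

lemma B_plus_first:
  "B_plus y (f # map basis_vec ts) = linear_ext (\<lambda>t. basis_vec (Node y (t # ts))) f"
  by (induction f rule: linear_induct) (simp_all add: B_plus_def forest_basis)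

lemma B_plus_last:
  "B_plus x (map basis_vec ss @ [f]) = linear_ext (\<lambda>t. basis_vec (Node x (ss @ [t]))) f"
proof -
  have "forest (map basis_vec ss @ [f]) = linear_ext (\<lambda>t. basis_vec (ss @ [t])) f"
  proof (induction ss)
    case Nil
    show ?case
      by (induction f rule: linear_induct) simp_all
  next
    case (Cons s ss)
    show ?case
      unfolding list.map append_Cons forest.simps Cons.IH
      by (induction f rule: linear_induct) simp_all
  qed
  moreover have "linear_ext (\<lambda>ts. basis_vec (Node x ts)) (linear_ext (\<lambda>t. basis_vec (ss @ [t])) f) =
      linear_ext (\<lambda>t. basis_vec (Node x (ss @ [t]))) f"
    by (induction f rule: linear_induct) simp_all
  ultimately show ?thesis
    by (simp add: B_plus_def)
qed

definition graft_first :: "'a \<Rightarrow> 'a ptree list \<Rightarrow> ('a ptree \<Rightarrow>\<^sub>0 'k::field) \<Rightarrow> ('a ptree \<Rightarrow>\<^sub>0 'k)" where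
  "graft_first y ts = linear_ext (\<lambda>t. basis_vec (Node y (t # ts)))"

definition graft_last :: "'a \<Rightarrow> 'a ptree list \<Rightarrow> ('a ptree \<Rightarrow>\<^sub>0 'k::field) \<Rightarrow> ('a ptree \<Rightarrow>\<^sub>0 'k)" where
  "graft_last x ss = linear_ext (\<lambda>t. basis_vec (Node x (ss @ [t])))"

text \<open>For a root with at least two children, \<open><\<close> and \<open>>\<close> act on
  different slots; here both outer slots vary and the inner children \<open>ts\<close> stay
  fixed.\<close>

definition graft_both ::
  "'a \<Rightarrow> 'a ptree list \<Rightarrow> ('a ptree \<Rightarrow>\<^sub>0 'k::field) \<Rightarrow> ('a ptree \<Rightarrow>\<^sub>0 'k) \<Rightarrow> ('a ptree \<Rightarrow>\<^sub>0 'k)" where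
  "graft_both y ts = bilinear_ext (\<lambda>s t. basis_vec (Node y (s # ts @ [t])))"

lemmas graft_defs = graft_first_def graft_last_def graft_both_def

lemmas product_defs = PT_lt_def PT_gt_def PT_sh_def

text \<open>An only child is both first and last, so the rules for either product apply to
  it.\<close>

lemma graft_last_Nil: "graft_last x [] = graft_first x []"
  by (simp add: graft_defs)

lemma tree_lt_leaf: "tree_lt (Node x []) T = graft_last x [] (basis_vec T)"
  using B_plus_last[of x "[]" "basis_vec T"] by (simp add: graft_defs)

lemma tree_lt_snoc:
  "tree_lt (Node x (ss @ [s])) T = graft_last x ss (basis_vec s sh\<^sub>T basis_vec T)"
  by (simp add: B_plus_last graft_defs product_defs)

lemma tree_gt_leaf: "tree_gt S (Node y []) = graft_first y [] (basis_vec S)"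
  using B_plus_first[of y "basis_vec S" "[]"] by (simp add: graft_defs)

lemma tree_gt_Cons:
  "tree_gt S (Node y (t # ts)) = graft_first y ts (basis_vec S sh\<^sub>T basis_vec t)"
  by (simp add: B_plus_first graft_defs product_defs)

declare tree_lt.simps [simp del] tree_gt.simps [simp del]

section \<open>Bilinearity of the products and of grafting\<close>

lemma PT_lt_basis: "basis_vec S <\<^sub>T basis_vec T = tree_lt S T"
  and PT_gt_basis: "basis_vec S >\<^sub>T basis_vec T = tree_gt S T"
  by (simp_all add: product_defs)

lemma PT_lt_linear:
  "(f + f') <\<^sub>T h = (f <\<^sub>T h) + (f' <\<^sub>T h)"
  "f <\<^sub>T (h + h') = (f <\<^sub>T h) + (f <\<^sub>T h')"
  "pm_scale r f <\<^sub>T h = pm_scale r (f <\<^sub>T h)"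
  "f <\<^sub>T pm_scale r h = pm_scale r (f <\<^sub>T h)"
  by (simp_all add: product_defs)

lemma PT_gt_linear:
  "(f + f') >\<^sub>T h = (f >\<^sub>T h) + (f' >\<^sub>T h)"
  "f >\<^sub>T (h + h') = (f >\<^sub>T h) + (f >\<^sub>T h')"
  "pm_scale r f >\<^sub>T h = pm_scale r (f >\<^sub>T h)"
  "f >\<^sub>T pm_scale r h = pm_scale r (f >\<^sub>T h)"
  by (simp_all add: product_defs)

lemma PT_sh_linear:
  "(f + f') sh\<^sub>T h = (f sh\<^sub>T h) + (f' sh\<^sub>T h)"
  "f sh\<^sub>T (h + h') = (f sh\<^sub>T h) + (f sh\<^sub>T h')"
  "pm_scale r f sh\<^sub>T h = pm_scale r (f sh\<^sub>T h)"
  "f sh\<^sub>T pm_scale r h = pm_scale r (f sh\<^sub>T h)"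
  by (simp_all add: product_defs pm.scale_right_distrib)

lemma graft_linear:
  "graft_first x ts (f + f') = graft_first x ts f + graft_first x ts f'"
  "graft_first x ts (pm_scale r f) = pm_scale r (graft_first x ts f)"
  "graft_last x ts (f + f') = graft_last x ts f + graft_last x ts f'"
  "graft_last x ts (pm_scale r f) = pm_scale r (graft_last x ts f)"
  "graft_both x ts (f + f') h = graft_both x ts f h + graft_both x ts f' h"
  "graft_both x ts f (h + h') = graft_both x ts f h + graft_both x ts f h'"
  "graft_both x ts (pm_scale r f) h = pm_scale r (graft_both x ts f h)"
  "graft_both x ts f (pm_scale r h) = pm_scale r (graft_both x ts f h)"
  by (simp_all add: graft_defs)

lemmas linear_simps = PT_lt_linear PT_gt_linear PT_sh_linear graft_linear

lemma graft_basis: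
  "graft_first y ts (basis_vec t) = basis_vec (Node y (t # ts))"
  "graft_last y ts (basis_vec t) = basis_vec (Node y (ts @ [t]))"
  "graft_both y ts (basis_vec s) (basis_vec t) = basis_vec (Node y (s # ts @ [t]))"
  by (simp_all add: graft_defs)

section \<open>The products on grafted vectors\<close>

lemma leaf_PT_lt: "basis_vec (Node x []) <\<^sub>T f = graft_last x [] f"
  by (induction f rule: linear_induct) (simp_all add: linear_simps PT_lt_basis tree_lt_leaf)

lemma PT_gt_leaf: "f >\<^sub>T basis_vec (Node y []) = graft_first y [] f"
  by (induction f rule: linear_induct) (simp_all add: linear_simps PT_gt_basis tree_gt_leaf)

text \<open>On trees this is \<open>tree_lt_snoc\<close>, and both sides are linear in
  \<open>f\<close> and in \<open>h\<close>. Having it for arbitrary vectors allows a product to be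
  applied to the result of another one.\<close>

lemma graft_last_PT_lt: "graft_last x ss f <\<^sub>T h = graft_last x ss (f sh\<^sub>T h)"
proof (induction f rule: linear_induct)
  case (basis s)
  show ?case
    by (induction h rule: linear_induct)
      (simp_all add: linear_simps graft_basis PT_lt_basis tree_lt_snoc)
qed (simp_all add: linear_simps)

lemma graft_first_PT_lt: "graft_first y [] f <\<^sub>T h = graft_first y [] (f sh\<^sub>T h)"
  using graft_last_PT_lt[of y "[]"] by (simp add: graft_last_Nil)

lemma PT_gt_graft_first: "h >\<^sub>T graft_first y ts f = graft_first y ts (h sh\<^sub>T f)"
proof (induction f rule: linear_induct)
  case (basis s)
  show ?case
    by (induction h rule: linear_induct)
      (simp_all add: linear_simps graft_basis PT_gt_basis tree_gt_Cons)
qed (simp_all add: linear_simps)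

lemma graft_both_basis_left: "graft_both y ts (basis_vec s) = graft_last y (s # ts)"
  by (simp add: graft_defs fun_eq_iff)

lemma graft_both_basis_right: "graft_both y ts f (basis_vec t) = graft_first y (ts @ [t]) f"
  by (induction f rule: linear_induct) (simp_all add: linear_simps graft_basis)

text \<open>Fixing a tree in the first slot turns \<open>graft_both\<close> into a
  \<open>graft_last\<close>, whose rule leaves that slot untouched.\<close>

lemma graft_both_PT_lt: "graft_both y ts f g <\<^sub>T h = graft_both y ts f (g sh\<^sub>T h)"
  by (induction f rule: linear_induct)
    (simp_all add: linear_simps graft_both_basis_left graft_last_PT_lt)

lemma PT_gt_graft_both: "h >\<^sub>T graft_both y ts f g = graft_both y ts (h sh\<^sub>T f) g"
  by (induction g rule: linear_induct)
    (simp_all add: linear_simps graft_both_basis_right PT_gt_graft_first)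

section \<open>The dendriform identities\<close>

lemma dendriform_basis:
  fixes s t u :: "'a ptree"
  defines "S \<equiv> basis_vec s :: 'a ptree \<Rightarrow>\<^sub>0 'k::field"
    and "T \<equiv> basis_vec t" and "U \<equiv> basis_vec u"
  shows "(S <\<^sub>T T) <\<^sub>T U = S <\<^sub>T (T sh\<^sub>T U) \<and>
    (S >\<^sub>T T) <\<^sub>T U = S >\<^sub>T (T <\<^sub>T U) \<and>
    (S sh\<^sub>T T) >\<^sub>T U = S >\<^sub>T (T >\<^sub>T U)"
  unfolding S_def T_def U_def
proof (induction "size s + size t + size u" arbitrary: s t u rule: less_induct)
  case less
  let ?b = "basis_vec :: 'a ptree \<Rightarrow> ('a ptree \<Rightarrow>\<^sub>0 'k)"
  \<comment> \<open>By bilinearity the left side splits into the left sides of the three identities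
    for \<open>p\<close>, \<open>q\<close>, \<open>r\<close>, and the right side into their right
    sides.\<close>
  have sh_assoc: "(?b p sh\<^sub>T ?b q) sh\<^sub>T ?b r = ?b p sh\<^sub>T (?b q sh\<^sub>T ?b r)"
    if "size p + size q + size r < size s + size t + size u" for p q r
    using less[OF that] by (simp add: PT_sh_def PT_lt_linear PT_gt_linear add_ac)
  have "(?b s <\<^sub>T ?b t) <\<^sub>T ?b u = ?b s <\<^sub>T (?b t sh\<^sub>T ?b u)"
  proof (cases s)
    case (Node x ss)
    show ?thesis
    proof (cases ss rule: rev_cases)
      case Nil
      with Node show ?thesis by (simp add: leaf_PT_lt graft_last_PT_lt)
    next
      case (snoc ss' s')
      then have "size s' < size s"
        unfolding Node by (intro size_child_less) simp
      then show ?thesis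
        \<comment> \<open>Writing \<open>s\<close> as a \<open>graft_last\<close> of
          \<open>s'\<close> turns the two sides into grafts of \<open>(s' sh t) sh u\<close> and
          \<open>s' sh (t sh u)\<close>.\<close>
        using sh_assoc[of s' t u]
        by (simp add: Node snoc graft_last_PT_lt flip: graft_basis(2))
    qed
  qed
  moreover have "(?b s >\<^sub>T ?b t) <\<^sub>T ?b u = ?b s >\<^sub>T (?b t <\<^sub>T ?b u)"
  proof (cases t)
    case (Node y ts)
    \<comment> \<open>The cases distinguish whether the first and last slots of \<open>t\<close> are
      absent, equal or distinct.\<close>
    consider "ts = []" | t' where "ts = [t']" | p ts' q where "ts = p # ts' @ [q]"
      by (metis rev_exhaust list.exhaust)
    then show ?thesis
    proof cases
      case 1
      with Node show ?thesis
        \<comment> \<open>Both sides are the graft of \<open>s sh u\<close> as the only child of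
          \<open>y\<close>.\<close>
        by (simp add: leaf_PT_lt PT_gt_leaf graft_last_Nil graft_first_PT_lt PT_gt_graft_first)
    next
      case 2
      then have "size t' < size t"
        unfolding Node by (intro size_child_less) simp
      \<comment> \<open>Both products meet at the single child \<open>t'\<close>, and the order in
        which they are applied is settled by associativity.\<close>
      then have assoc: "(?b s sh\<^sub>T ?b t') sh\<^sub>T ?b u = ?b s sh\<^sub>T (?b t' sh\<^sub>T ?b u)"
        by (intro sh_assoc) simp
      have first: "?b t = graft_first y [] (?b t')"
        by (simp add: Node 2 graft_basis)
      show ?thesis
        by (simp add: first graft_first_PT_lt PT_gt_graft_first assoc)
    next
      case 3
      with Node show ?thesis
        \<comment> \<open>\<open>s\<close> is absorbed by the first child and \<open>u\<close> by
          the last one; these operations commute without the induction hypothesis.\<close>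
        by (simp add: graft_both_PT_lt PT_gt_graft_both flip: graft_basis(3))
    qed
  qed
  moreover have "(?b s sh\<^sub>T ?b t) >\<^sub>T ?b u = ?b s >\<^sub>T (?b t >\<^sub>T ?b u)"
  proof (cases u)
    case (Node z us)
    show ?thesis
    proof (cases us)
      case Nil
      with Node show ?thesis by (simp add: PT_gt_leaf PT_gt_graft_first)
    next
      case (Cons u' us')
      then have "size u' < size u"
        unfolding Node by (intro size_child_less) simp
      then show ?thesis
        \<comment> \<open>Both sides graft onto the first slot of \<open>u\<close>, with contents
          \<open>(s sh t) sh u'\<close> and \<open>s sh (t sh u')\<close>.\<close>
        using sh_assoc[of s t u']
        by (simp add: Node Cons PT_gt_graft_first flip: graft_basis(1))
    qed
  qed
  ultimately show ?case by blast
qed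

lemma dendriform_identities:
  fixes S T U :: "'a ptree \<Rightarrow>\<^sub>0 'k::field"
  shows "(S <\<^sub>T T) <\<^sub>T U = S <\<^sub>T (T sh\<^sub>T U) \<and>
    (S >\<^sub>T T) <\<^sub>T U = S >\<^sub>T (T <\<^sub>T U) \<and>
    (S sh\<^sub>T T) >\<^sub>T U = S >\<^sub>T (T >\<^sub>T U)"
proof (induction S rule: linear_induct)
  case (basis s)
  show ?case
  proof (induction T rule: linear_induct)
    case (basis t)
    show ?case
    proof (induction U rule: linear_induct)
      case (basis u)
      show ?case by (rule dendriform_basis)
    qed (simp_all add: linear_simps)
  qed (simp_all add: linear_simps)
qed (simp_all add: linear_simps)

section \<open>Closure under the products\<close>

lemma subspace_PT_space: "pm.subspace (PT_space \<Omega>)"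
  unfolding pm.subspace_def PT_space_def
  by (auto simp: in_keys_iff lookup_add subset_iff) (metis add_0)

lemma basis_vec_in_PT_space: "T \<in> PT_trees \<Omega> \<Longrightarrow> basis_vec T \<in> PT_space \<Omega>"
  by (simp add: PT_space_def basis_vec_def)

lemma keys_PT_space: "f \<in> PT_space \<Omega> \<Longrightarrow> T \<in> Poly_Mapping.keys f \<Longrightarrow> T \<in> PT_trees \<Omega>"
  by (auto simp: PT_space_def)

lemma Node_in_PT_trees: "Node x ts \<in> PT_trees \<Omega> \<longleftrightarrow> x \<in> \<Omega> \<and> set ts \<subseteq> PT_trees \<Omega>"
  by (auto simp: PT_trees_def)

lemma graft_in_PT_space:
  assumes "f \<in> PT_space \<Omega>" "x \<in> \<Omega>" "set ts \<subseteq> PT_trees \<Omega>"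
  shows "graft_first x ts f \<in> PT_space \<Omega>" "graft_last x ts f \<in> PT_space \<Omega>"
  using assms unfolding graft_defs
  by (auto intro!: linear_ext_in_subspace subspace_PT_space basis_vec_in_PT_space
      dest: keys_PT_space simp: Node_in_PT_trees)

text \<open>Each product recurses through the sum of both products on a smaller pair of trees, so
  closure is proved for the two together. Grafting then adds only decorations already present in
  \<open>S\<close> or \<open>T\<close>.\<close>

lemma tree_products_in_PT_space:
  fixes S T :: "'a ptree"
  assumes "S \<in> PT_trees \<Omega>" "T \<in> PT_trees \<Omega>"
  shows "tree_lt S T \<in> (PT_space \<Omega> :: ('a ptree \<Rightarrow>\<^sub>0 'k::field) set) \<and>
    tree_gt S T \<in> (PT_space \<Omega> :: ('a ptree \<Rightarrow>\<^sub>0 'k) set)"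
  using assms
proof (induction "size S + size T" arbitrary: S T rule: less_induct)
  case less
  have sh: "basis_vec p sh\<^sub>T basis_vec q \<in> (PT_space \<Omega> :: ('a ptree \<Rightarrow>\<^sub>0 'k) set)"
    if "size p + size q < size S + size T" "p \<in> PT_trees \<Omega>" "q \<in> PT_trees \<Omega>" for p q
    using less.hyps[OF that]
    by (auto simp: PT_sh_def PT_lt_basis PT_gt_basis
        intro: pm.subspace_add[OF subspace_PT_space])
  have "tree_lt S T \<in> (PT_space \<Omega> :: ('a ptree \<Rightarrow>\<^sub>0 'k) set)"
  proof (cases S)
    case (Node x ss)
    show ?thesis
    proof (cases ss rule: rev_cases)
      case Nil
      with Node less.prems show ?thesis
        by (auto simp: tree_lt_leaf Node_in_PT_trees
            intro!: graft_in_PT_space basis_vec_in_PT_space)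
    next
      case (snoc ss' s')
      then have "size s' < size S"
        unfolding Node by (intro size_child_less) simp
      with Node snoc less.prems show ?thesis
        by (auto simp: tree_lt_snoc Node_in_PT_trees simp del: ptree.size
            intro!: graft_in_PT_space sh)
    qed
  qed
  moreover have "tree_gt S T \<in> (PT_space \<Omega> :: ('a ptree \<Rightarrow>\<^sub>0 'k) set)"
  proof (cases T)
    case (Node y ts)
    show ?thesis
    proof (cases ts)
      case Nil
      with Node less.prems show ?thesis
        by (auto simp: tree_gt_leaf Node_in_PT_trees
            intro!: graft_in_PT_space basis_vec_in_PT_space)
    next
      case (Cons t' ts')
      then have "size t' < size T"
        unfolding Node by (intro size_child_less) simp
      with Node Cons less.prems show ?thesis
        by (auto simp: tree_gt_Cons Node_in_PT_trees simp del: ptree.size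
            intro!: graft_in_PT_space sh)
    qed
  qed
  ultimately show ?case ..
qed

lemma PT_products_in_PT_space:
  assumes "f \<in> PT_space \<Omega>" "g \<in> PT_space \<Omega>"
  shows "f <\<^sub>T g \<in> PT_space \<Omega>" "f >\<^sub>T g \<in> PT_space \<Omega>"
  using assms tree_products_in_PT_space[of _ \<Omega>] unfolding product_defs bilinear_ext_def
  by (auto intro!: linear_ext_in_subspace subspace_PT_space dest: keys_PT_space)

theorem proposition13:
  fixes \<Omega> :: "'a set"
  shows "dendriform_algebra pm_scale (PT_space \<Omega> :: ('a ptree \<Rightarrow>\<^sub>0 'k::field) set) PT_lt PT_gt \<and>
    (\<forall>S \<in> (PT_space \<Omega> :: ('a ptree \<Rightarrow>\<^sub>0 'k) set). \<forall>T \<in> PT_space \<Omega>. \<forall>U \<in> PT_space \<Omega>.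
       (S <\<^sub>T T) <\<^sub>T U = S <\<^sub>T (T sh\<^sub>T U) \<and>
       (S >\<^sub>T T) <\<^sub>T U = S >\<^sub>T (T <\<^sub>T U) \<and>
       (S sh\<^sub>T T) >\<^sub>T U = S >\<^sub>T (T >\<^sub>T U))"
proof
  show "dendriform_algebra pm_scale (PT_space \<Omega> :: ('a ptree \<Rightarrow>\<^sub>0 'k) set) PT_lt PT_gt"
    \<comment> \<open>The locale writes out \<open>sh\<close> as a sum; the identities are unfolded
      and expanded by bilinearity so that they match the goals expanded in the same way.\<close>
    by unfold_locales
      (simp_all add: subspace_PT_space PT_products_in_PT_space PT_lt_linear PT_gt_linear
        dendriform_identities[unfolded PT_sh_def, simplified PT_lt_linear PT_gt_linear])
qed (use dendriform_identities in blast)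

end
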